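(* Let $(K,\mathcal{K})$ be a measurable space and let $(T_{\mathsf{k}})_{\mathsf{k}\in K}$ be a family of firmly quasinonexpansive operators from $H$ to $H$ such that the map $\boldsymbol{T}\colon(K\times H,\mathcal{K}\otimes\mathcal{B}_H)\to(H,\mathcal{B}_H)\colon(\mathsf{k},\mathsf{x})\mapsto T_{\mathsf{k}}\mathsf{x}$ is measurable and, for every $\mathsf{k}\in K$, $\mathrm{Id}-T_{\mathsf{k}}$ is demiclosed at $0$. Let $k$ be a $K$-valued random variable on $(\Omega,\mathcal{F},P)$, suppose that $$Z=\{\mathsf{z}\in H\mid \mathsf{z}\in\mathrm{Fix}\,T_k\ \ P\text{-a.s.}\}\neq\varnothing,$$ and let $x_0\in L^2(\Omega,\mathcal{F},P;H)$. Let $M\in\mathbb{N}$ with $M>0$, let $\delta\in\left]0,1/M\right[$, and let $\varepsilon\in\left]0,1\right[$. Let $(x_n)_{n\in\mathbb{N}}$ be a sequence generated by the following iteration: for every $n\in\mathbb{N}$, - $\mathcal{X}_n=\sigma(x_0,\ldots,x_n)$; - for every $i\in\{1,\ldots,M\}$, $k_{i,n}$ is a copy of $k$ and is independent of $\mathcal{X}_n$, and $p_{i,n}=T_{k_{i,n}}x_n$; - $(\beta_{i,n})_{1\leq i\leq M}$ are $[0,1]$-valued random variables such that $\sum_{i=1}^M\beta_{i,n}=1$ $P$-a.s. and, for every $i\in\{1,\ldots,M\}$, $\beta_{i,n}\geq\delta\,1_{[\|p_{i,n}-x_n\|_H=\max_{1\leq j\leq M}\|p_{j,n}-x_n\|_H]}$;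 - $p_n=\sum_{i=1}^M\beta_{i,n}p_{i,n}$; - $L_n=\dfrac{\sum_{i=1}^M\beta_{i,n}\|p_{i,n}-x_n\|_H^2+1_{[p_n=x_n]}}{\|p_n-x_n\|_H^2+1_{[p_n=x_n]}}$; - $a_n=x_n+L_n(p_n-x_n)$; - take $\lambda_n\in L^\infty(\Omega,\mathcal{F},P;[\varepsilon,1])$; - $r_n=x_n+\lambda_n(a_n-x_n)$; - $x_{n+1}=Q(x_0,x_n,r_n)$. Then $(x_n)_{n\in\mathbb{N}}$ converges strongly $P$-a.s. and strongly in $L^2(\Omega,\mathcal{F},P;H)$ to $\mathrm{proj}_Zx_0$.
   Context: $H$ is a separable real Hilbert space with identity operator $\mathrm{Id}$, scalar product $\langle\cdot\mid\cdot\rangle_H$, norm $\|\cdot\|_H$, and Borel $\sigma$-algebra $\mathcal{B}_H$. $(\Omega,\mathcal{F},P)$ is a complete probability space and $\mathsf{E}$ denotes expectation. $L^2(\Omega,\mathcal{F},P;H)$ is the Hilbert space of ($P$-a.s. equivalence classes of) measurable maps $x\colon(\Omega,\mathcal{F})\to(H,\mathcal{B}_H)$ with $\mathsf{E}\|x\|_H^2<+\infty$. $L^\infty(\Omega,\mathcal{F},P;[\varepsilon,1])$ is the set of essentially bounded real random variables with values in $[\varepsilon,1]$. $\sigma(x_0,\ldots,x_n)$ is the sub-$\sigma$-algebra of $\mathcal{F}$ generated by $x_0,\ldots,x_n$. A $K$-valued random variable is a measurable map $(\Omega,\mathcal{F})\to(K,\mathcal{K})$; $y$ is a copy of $x$ if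 $P([y\in S])=P([x\in S])$ for every $S\in\mathcal{K}$. $1_A$ is the indicator function of an event $A$, and $[\cdots]$ denotes the event that the bracketed condition holds. $\mathrm{Fix}\,T=\{\mathsf{x}\in H\mid T\mathsf{x}=\mathsf{x}\}$. An operator $T\colon H\to H$ is firmly quasinonexpansive if $$(\forall\mathsf{x}\in H)(\forall\mathsf{y}\in\mathrm{Fix}\,T)\quad\|T\mathsf{x}-\mathsf{y}\|_H^2+\|T\mathsf{x}-\mathsf{x}\|_H^2\leq\|\mathsf{x}-\mathsf{y}\|_H^2.$$ An operator $T\colon H\to H$ is demiclosed at $\mathsf{y}\in H$ if for every $\mathsf{x}\in H$ and every sequence $(\mathsf{x}_n)_{n\in\mathbb{N}}$ in $H$ such that $\mathsf{x}_n\rightharpoonup\mathsf{x}$ (weakly) and $T\mathsf{x}_n\to\mathsf{y}$ (strongly), we have $T\mathsf{x}=\mathsf{y}$. The statement $\mathsf{z}\in\mathrm{Fix}\,T_k$ $P$-a.s. means $\mathsf{z}\in\mathrm{Fix}\,T_{k(\omega)}$ for $P$-almost every $\omega\in\Omega$; $T_{k_{i,n}}x_n$ is $\omega\mapsto T_{k_{i,n}(\omega)}x_n(\omega)$. $\mathrm{proj}_C$ is the projection operator onto a nonempty closed convex set $C\subset H$ (the set $Z$ is closed and convex), and $\mathrm{proj}_Zx_0$ is $\omega\mapsto\mathrm{proj}_Z(x_0(\omega))$. For $(\mathsf{x},\mathsf{y},\mathsf{z})\in H^3$ define $$H(\mathsf{x},\mathsf{y})=\{\mathsf{w}\in H\mid\langle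 \mathsf{w}-\mathsf{y}\mid \mathsf{x}-\mathsf{y}\rangle_H\leq0\},$$ $$O(\mathsf{x},\mathsf{y},\mathsf{z})=\begin{cases}H(\mathsf{x},\mathsf{y})\cap H(\mathsf{y},\mathsf{z}),&\text{if }H(\mathsf{x},\mathsf{y})\cap H(\mathsf{y},\mathsf{z})\neq\varnothing;\\ \{\mathsf{y}\},&\text{if }H(\mathsf{x},\mathsf{y})\cap H(\mathsf{y},\mathsf{z})=\varnothing,\end{cases}$$ $$Q(\mathsf{x},\mathsf{y},\mathsf{z})=\mathrm{proj}_{O(\mathsf{x},\mathsf{y},\mathsf{z})}\mathsf{x}.$$ Applied to $H$-valued random variables, $Q$ is understood pointwise in $\omega$. *)

theory Defs
  imports "HOL-Probability.Probability"
begin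

definition Fix :: "('h \<Rightarrow> 'h) \<Rightarrow> 'h set" where
  "Fix T = {x. T x = x}"

definition firmly_quasinonexpansive :: "('h::real_normed_vector \<Rightarrow> 'h) \<Rightarrow> bool" where
  "firmly_quasinonexpansive T \<longleftrightarrow>
     (\<forall>x. \<forall>y\<in>Fix T. (norm (T x - y))\<^sup>2 + (norm (T x - x))\<^sup>2 \<le> (norm (x - y))\<^sup>2)"

definition weakly_converges :: "(nat \<Rightarrow> 'h::real_inner) \<Rightarrow> 'h \<Rightarrow> bool" where
  "weakly_converges xs x \<longleftrightarrow> (\<forall>u. (\<lambda>n. inner (xs n) u) \<longlonglongrightarrow> inner x u)"

definition demiclosed_at :: "('h::real_inner \<Rightarrow> 'h) \<Rightarrow> 'h \<Rightarrow> bool" where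
  "demiclosed_at T y \<longleftrightarrow>
     (\<forall>xs x. weakly_converges xs x \<longrightarrow> (\<lambda>n. T (xs n)) \<longlonglongrightarrow> y \<longrightarrow> T x = y)"

(* The library's closest_point is restricted to the class heine_borel, which excludes
   infinite-dimensional Hilbert spaces.  The value is meaningful whenever the best
   approximation exists and is unique, in particular for C nonempty, closed and convex. *)
definition proj :: "'h::real_inner set \<Rightarrow> 'h \<Rightarrow> 'h" where
  "proj C x = (THE p. p \<in> C \<and> (\<forall>y\<in>C. dist x p \<le> dist x y))"

(* The set H(x, y); it is all of the space if x = y. *)
definition half :: "'h::real_inner \<Rightarrow> 'h \<Rightarrow> 'h set" where
  "half x y = {w. inner (w - y) (x - y) \<le> 0}"

definition outer :: "'h::real_inner \<Rightarrow> 'h \<Rightarrow> 'h \<Rightarrow> 'h set" where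
  "outer x y z = (if half x y \<inter> half y z \<noteq> {} then half x y \<inter> half y z else {y})"

definition Q :: "'h::real_inner \<Rightarrow> 'h \<Rightarrow> 'h \<Rightarrow> 'h" where
  "Q x y z = proj (outer x y z) x"

(* Members of L^2 are represented by functions, not by classes modulo a.s. equality. *)
definition in_L2 :: "'a measure \<Rightarrow> ('a \<Rightarrow> 'h::real_normed_vector) \<Rightarrow> bool" where
  "in_L2 P f \<longleftrightarrow> f \<in> borel_measurable P \<and> integrable P (\<lambda>\<omega>. (norm (f \<omega>))\<^sup>2)"

definition converges_in_L2 ::
  "'a measure \<Rightarrow> (nat \<Rightarrow> 'a \<Rightarrow> 'h::real_normed_vector) \<Rightarrow> ('a \<Rightarrow> 'h) \<Rightarrow> bool" where
  "converges_in_L2 P fs f \<longleftrightarrow> (\<forall>n. in_L2 P (fs n)) \<and> in_L2 P f \<and>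
     (\<lambda>n. sqrt (LINT \<omega>|P. (norm (fs n \<omega> - f \<omega>))\<^sup>2)) \<longlonglongrightarrow> 0"

definition is_copy :: "'a measure \<Rightarrow> 'k measure \<Rightarrow> ('a \<Rightarrow> 'k) \<Rightarrow> ('a \<Rightarrow> 'k) \<Rightarrow> bool" where
  "is_copy P K y x \<longleftrightarrow> y \<in> measurable P K \<and>
     (\<forall>S\<in>sets K. measure P (y -` S \<inter> space P) = measure P (x -` S \<inter> space P))"

definition sigma_rv :: "'a measure \<Rightarrow> 'k measure \<Rightarrow> ('a \<Rightarrow> 'k) \<Rightarrow> 'a set set" where
  "sigma_rv P K y = {y -` S \<inter> space P | S. S \<in> sets K}"

(* The sigma-algebra generated by x 0, ..., x n. *)
definition sigma_upto ::
  "'a measure \<Rightarrow> (nat \<Rightarrow> 'a \<Rightarrow> 'h::topological_space) \<Rightarrow> nat \<Rightarrow> 'a set set" where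
  "sigma_upto P x n = sigma_sets (space P) (\<Union>j\<le>n. sigma_rv P borel (x j))"

end

theory Submission
  imports Defs
begin

text \<open>
  For almost every \<open>\<omega>\<close> every operator drawn along the way fixes all of \<open>Z\<close>, because \<open>Z\<close> is separable.
  Hence \<open>Z\<close> lies in each half-space of the outer approximation, and Haugazeau's
  argument bounds \<open>\<parallel>x\<^sub>n - x\<^sub>0\<parallel>\<close> by \<open>\<parallel>z - x\<^sub>0\<parallel>\<close> and \<open>\<Sum>\<^sub>n \<parallel>r\<^sub>n - x\<^sub>n\<parallel>\<^sup>2\<close> by \<open>\<parallel>z - x\<^sub>0\<parallel>\<^sup>2\<close> for \<open>z \<in> Z\<close>.
  The extrapolated step dominates \<open>\<parallel>p\<^sub>1\<^sub>,\<^sub>n - x\<^sub>n\<parallel>\<close> up to a constant, so the expected squares of these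
  displacements are summable. Since \<open>k\<^sub>1\<^sub>,\<^sub>n\<close> is independent of \<open>x\<^sub>n\<close> and has the law \<open>\<mu>\<close> of \<open>k\<close>, this means that
  for almost every \<open>\<omega>\<close> and \<open>\<mu>\<close>-almost every fixed \<open>\<kappa>\<close> the series \<open>\<Sum>\<^sub>n \<parallel>T\<^sub>\<kappa> x\<^sub>n - x\<^sub>n\<parallel>\<^sup>2\<close> converges. Demiclosedness then puts
  every weak cluster point of \<open>(x\<^sub>n)\<close> into \<open>Z\<close>, and the norm bound upgrades weak to strong convergence.
\<close>

section \<open>Projections and weak compactness in Hilbert spaces\<close>

text \<open>A minimizing sequence is Cauchy: midpoints stay in the convex set \<open>C\<close>, so
  by the parallelogram law two nearly optimal points are close to each other. Completeness then
  yields the minimizer.\<close>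

lemma closest_point_ex1:
  fixes C :: "'h::{real_inner,banach} set"
  assumes "closed C" "convex C" "C \<noteq> {}"
  shows "\<exists>!p. p \<in> C \<and> (\<forall>y\<in>C. dist x p \<le> dist x y)"
proof -
  define d where "d = infdist x C"
  have d_le: "d \<le> dist x y" if "y \<in> C" for y
    unfolding d_def using that by (rule infdist_le)
  have d0: "0 \<le> d" unfolding d_def by (rule infdist_nonneg)
  have "\<exists>y\<in>C. dist x y < d + 1 / real (Suc n)" for n
  proof (rule ccontr)
    assume "\<not> ?thesis"
    then have "d + 1 / real (Suc n) \<le> d"
      unfolding d_def infdist_notempty[OF assms(3)]
      by (intro cINF_greatest) (use assms(3) in \<open>auto simp: not_less infdist_notempty\<close>)
    then show False by (simp add: divide_le_0_iff)
  qed
  then obtain Y where Y: "\<And>n. Y n \<in> C" "\<And>n. dist x (Y n) < d + 1 / real (Suc n)"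
    by metis
  have lim: "(\<lambda>n. dist x (Y n)) \<longlonglongrightarrow> d"
  proof (rule real_tendsto_sandwich[where f="\<lambda>_. d" and h="\<lambda>n. d + 1 / real (Suc n)"])
    have "(\<lambda>n. 1 / real (Suc n)) \<longlonglongrightarrow> 0" by (rule LIMSEQ_Suc[OF lim_1_over_n])
    then show "(\<lambda>n. d + 1 / real (Suc n)) \<longlonglongrightarrow> d"
      using tendsto_add[OF tendsto_const[of d]] by fastforce
  qed (auto intro!: always_eventually d_le Y(1) less_imp_le[OF Y(2)] simp del: of_nat_Suc)
  have parallelogram:
    "(dist u v)\<^sup>2 \<le> 2 * ((dist x u)\<^sup>2 - d\<^sup>2) + 2 * ((dist x v)\<^sup>2 - d\<^sup>2)" if "u \<in> C" "v \<in> C" for u v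
  proof -
    have "(1/2) *\<^sub>R u + (1/2) *\<^sub>R v \<in> C"
      using assms(2) that by (intro convexD) auto
    then have "d\<^sup>2 \<le> (dist x ((1/2) *\<^sub>R u + (1/2) *\<^sub>R v))\<^sup>2"
      using d_le d0 by (intro power_mono) auto
    then show ?thesis
      unfolding dist_norm power2_norm_eq_inner
      by (simp add: inner_diff inner_add inner_commute algebra_simps)
  qed
  have "Cauchy Y"
  proof (rule metric_CauchyI)
    fix e :: real assume "0 < e"
    have "(\<lambda>n. (dist x (Y n))\<^sup>2) \<longlonglongrightarrow> d\<^sup>2" by (intro tendsto_intros lim)
    \<comment> \<open>With this margin each of the two terms of \<open>parallelogram\<close> stays
      below \<open>e\<^sup>2 / 2\<close>.\<close>
    then have "eventually (\<lambda>n. (dist x (Y n))\<^sup>2 < d\<^sup>2 + e\<^sup>2 / 4) sequentially"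
      using \<open>0 < e\<close> by (intro order_tendstoD) auto
    then obtain N where N: "\<And>n. n \<ge> N \<Longrightarrow> (dist x (Y n))\<^sup>2 < d\<^sup>2 + e\<^sup>2 / 4"
      by (auto simp: eventually_sequentially)
    have "dist (Y m) (Y n) < e" if "m \<ge> N" "n \<ge> N" for m n
    proof -
      have "(dist (Y m) (Y n))\<^sup>2 < e\<^sup>2"
        using parallelogram[OF Y(1) Y(1), of m n] N[OF that(1)] N[OF that(2)] by simp
      then show ?thesis using \<open>0 < e\<close> by (simp add: power_less_imp_less_base)
    qed
    then show "\<exists>N. \<forall>m\<ge>N. \<forall>n\<ge>N. dist (Y m) (Y n) < e" by blast
  qed
  then obtain q where q: "Y \<longlonglongrightarrow> q"
    using convergent_eq_Cauchy by blast
  have "q \<in> C" using assms(1) Y(1) q closed_sequentially by blast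
  moreover have "dist x q = d"
    using tendsto_dist[OF tendsto_const q] lim LIMSEQ_unique by blast
  ultimately show ?thesis
    using d_le assms by (intro ex1I[of _ q]) (auto intro: any_closest_point_unique[of C _ _ x])
qed

lemma
  fixes C :: "'h::{real_inner,banach} set"
  assumes "closed C" "convex C" "C \<noteq> {}"
  shows proj_in: "proj C x \<in> C"
    and proj_le: "y \<in> C \<Longrightarrow> dist x (proj C x) \<le> dist x y"
  using theI'[OF closest_point_ex1[OF assms, of x]] unfolding proj_def by auto

lemma proj_eqI:
  fixes C :: "'h::real_inner set"
  assumes "closed C" "convex C" "q \<in> C" "\<And>y. y \<in> C \<Longrightarrow> dist x q \<le> dist x y"
  shows "proj C x = q"
  unfolding proj_def using assms
  by (intro the_equality) (auto intro: any_closest_point_unique[of C _ _ x])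

lemma proj_inner_le:
  fixes C :: "'h::{real_inner,banach} set"
  assumes "closed C" "convex C" "w \<in> C"
  shows "inner (w - proj C x) (x - proj C x) \<le> 0"
  using any_closest_point_dot[OF assms(2,1) proj_in assms(3), of x] proj_le[OF assms(1,2)] assms
  by (force simp: inner_commute)

text \<open>Adding the variational inequalities at the two projections bounds the squared distance
  by an inner product, and Cauchy-Schwarz finishes. The resulting continuity later makes the
  pointwise projection of a random variable measurable.\<close>

lemma proj_nonexpansive:
  fixes C :: "'h::{real_inner,banach} set"
  assumes "closed C" "convex C" "C \<noteq> {}"
  shows "dist (proj C x) (proj C y) \<le> dist x y"
proof -
  have "inner (proj C y - proj C x) (x - proj C x) \<le> 0" "inner (proj C x - proj C y) (y - proj C y) \<le> 0"
    by (intro proj_inner_le proj_in assms)+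
  then have "(norm (proj C x - proj C y))\<^sup>2 \<le> inner (proj C x - proj C y) (x - y)"
    unfolding power2_norm_eq_inner by (simp add: inner_diff inner_commute algebra_simps)
  also have "\<dots> \<le> norm (proj C x - proj C y) * norm (x - y)"
    by (rule norm_cauchy_schwarz)
  finally show ?thesis
    unfolding dist_norm power2_eq_square
    by (cases "norm (proj C x - proj C y) = 0") (auto simp del: norm_eq_zero simp: mult_le_cancel_left)
qed

lemma continuous_on_proj:
  fixes C :: "'h::{real_inner,banach} set"
  assumes "closed C" "convex C" "C \<noteq> {}"
  shows "continuous_on A (proj C)"
  using proj_nonexpansive[OF assms] unfolding continuous_on_iff by (meson le_less_trans)

text \<open>The point \<open>q\<close> of the hyperplane \<open>f = 1\<close> nearest to the origin
  is orthogonal to the kernel of \<open>f\<close>; rescaling it by \<open>1 / inner q q\<close>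
  gives the representing vector.\<close>

lemma riesz_representation:
  fixes f :: "'h::{real_inner,banach} \<Rightarrow> real"
  assumes f: "bounded_linear f"
  shows "\<exists>w. \<forall>u. f u = inner w u"
proof (cases "\<forall>u. f u = 0")
  case True
  then show ?thesis by (intro exI[of _ 0]) simp
next
  case False
  interpret f: bounded_linear f by fact
  define C where "C = {v. f v = 1}"
  obtain u0 where u0: "f u0 \<noteq> 0" using False by blast
  have C: "closed C" "convex C" "C \<noteq> {}"
  proof -
    show "closed C" unfolding C_def
      by (intro closed_Collect_eq continuous_intros f.continuous_on)
    show "convex C" unfolding C_def convex_def by (auto simp: f.add f.scaleR)
    have "(1 / f u0) *\<^sub>R u0 \<in> C" using u0 by (simp add: C_def f.scaleR)
    then show "C \<noteq> {}" by blast
  qed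
  define q where "q = proj C 0"
  have fq: "f q = 1" using proj_in[OF C] by (simp add: q_def C_def)
  have ker: "inner q v = 0" if "f v = 0" for v
  proof -
    have "q + v \<in> C" "q - v \<in> C" using fq that by (simp_all add: C_def f.add f.diff)
    then have "inner (q + v - q) (0 - q) \<le> 0" "inner (q - v - q) (0 - q) \<le> 0"
      using proj_inner_le[OF C(1,2), of _ 0, folded q_def] by blast+
    then show ?thesis by (simp add: inner_commute)
  qed
  have "q \<noteq> 0" using fq f.zero by auto
  have eq: "inner q u = f u * inner q q" for u
    using ker[of "u - f u *\<^sub>R q"] by (simp add: f.diff f.scaleR fq inner_diff)
  have "f u = inner ((1 / inner q q) *\<^sub>R q) u" for u
    using eq[of u] \<open>q \<noteq> 0\<close> by simp
  then show ?thesis by blast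
qed

text \<open>A diagonal subsequence makes the inner products with a countable dense set converge.
  Boundedness carries this over to all vectors, and the limit functional is bounded, so Riesz
  provides the weak limit.\<close>

lemma bounded_weakly_convergent_subseq:
  fixes X :: "nat \<Rightarrow> 'h::{real_inner,banach,second_countable_topology}"
  assumes B: "\<And>n. norm (X n) \<le> B"
  obtains s w where "strict_mono s" "weakly_converges (X \<circ> s) w"
proof -
  have B0: "0 \<le> B" using order_trans[OF norm_ge_zero B[of 0]] .
  have ip: "\<bar>inner (X n) u\<bar> \<le> B * norm u" for n u
    by (rule order_trans[OF Cauchy_Schwarz_ineq2 mult_right_mono[OF B norm_ge_zero]])
  obtain D :: "'h set" where D: "countable D" "\<And>U. open U \<Longrightarrow> U \<noteq> {} \<Longrightarrow> \<exists>d\<in>D. d \<in> U"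
    using countable_dense_exists by blast
  define d where "d = from_nat_into D"
  have dense: "\<exists>n. dist (d n) u < e" if e: "0 < e" for u e
  proof -
    have "ball u e \<noteq> {}" using e by simp
    then obtain c where c: "c \<in> D" "c \<in> ball u e" using D(2)[OF open_ball] by blast
    obtain n where "d n = c" using from_nat_into_surj[OF D(1) c(1)] unfolding d_def by blast
    then show ?thesis using c(2) by (auto simp: dist_commute)
  qed
  interpret subseqs "\<lambda>n s. convergent (\<lambda>m. inner (X (s m)) (d n))"
  proof
    fix n and s :: "nat \<Rightarrow> nat"
    have "bounded (range (\<lambda>m. inner (X (s m)) (d n)))"
      using ip by (intro boundedI[where B="B * norm (d n)"]) auto
    then obtain l r where "strict_mono r" "((\<lambda>m. inner (X (s m)) (d n)) \<circ> r) \<longlonglongrightarrow> l"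
      using bounded_imp_convergent_subsequence by blast
    then show "\<exists>r'. strict_mono r' \<and> convergent (\<lambda>m. inner (X ((s \<circ> r') m)) (d n))"
      by (auto simp: convergent_def o_def)
  qed
  define s where "s = diagseq"
  \<comment> \<open>The property for \<open>n\<close> is available only along the tail of
    \<open>diagseq\<close> shifted by \<open>Suc n\<close>; dropping an initial segment does not
    affect convergence.\<close>
  have conv_d: "convergent (\<lambda>m. inner (X (s m)) (d n))" for n
  proof -
    have "convergent (\<lambda>m. inner (X ((diagseq \<circ> (+) (Suc n)) m)) (d n))"
    proof (rule diagseq_holds)
      fix r s' :: "nat \<Rightarrow> nat" and n assume "strict_mono r" "convergent (\<lambda>m. inner (X (s' m)) (d n))"
      then show "convergent (\<lambda>m. inner (X ((s' \<circ> r) m)) (d n))"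
        using convergent_subseq_convergent[of "\<lambda>m. inner (X (s' m)) (d n)" r] by (simp add: o_def)
    qed
    then show ?thesis
      unfolding s_def using convergent_ignore_initial_segment[of "\<lambda>m. inner (X (diagseq m)) (d n)" "Suc n"]
      by (simp add: add.commute)
  qed
  have conv: "convergent (\<lambda>m. inner (X (s m)) u)" for u
    unfolding Cauchy_convergent_iff[symmetric]
  proof (rule metric_CauchyI)
    fix e :: real assume "0 < e"
    \<comment> \<open>Three errors of \<open>e / 4\<close> are added below; \<open>B + 1\<close> in
      place of \<open>B\<close> keeps the divisor positive.\<close>
    obtain n where n: "dist (d n) u < e / (4 * (B + 1))"
      using dense[of "e / (4 * (B + 1))"] \<open>0 < e\<close> B0 by auto
    have near: "\<bar>inner (X m) u - inner (X m) (d n)\<bar> < e / 4" for m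
    proof -
      have "\<bar>inner (X m) u - inner (X m) (d n)\<bar> \<le> B * dist (d n) u"
        using ip[of m "u - d n"] by (simp add: inner_diff dist_norm norm_minus_commute)
      also have "\<dots> \<le> (B + 1) * dist (d n) u" by (simp add: mult_right_mono)
      also have "\<dots> < (B + 1) * (e / (4 * (B + 1)))"
        using n B0 by (intro mult_strict_left_mono) auto
      also have "\<dots> = e / 4" using B0 by (simp add: field_simps)
      finally show ?thesis .
    qed
    obtain N where N: "\<And>i j. i \<ge> N \<Longrightarrow> j \<ge> N \<Longrightarrow> dist (inner (X (s i)) (d n)) (inner (X (s j)) (d n)) < e / 4"
      using metric_CauchyD[OF convergent_Cauchy[OF conv_d[of n]], of "e / 4"] \<open>0 < e\<close> by auto
    have "dist (inner (X (s i)) u) (inner (X (s j)) u) < e" if "i \<ge> N" "j \<ge> N" for i j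
      using near[of "s i"] near[of "s j"] N[OF that] \<open>0 < e\<close> unfolding dist_real_def by linarith
    then show "\<exists>N. \<forall>i\<ge>N. \<forall>j\<ge>N. dist (inner (X (s i)) u) (inner (X (s j)) u) < e" by blast
  qed
  define f where "f u = lim (\<lambda>m. inner (X (s m)) u)" for u
  have lim_f: "(\<lambda>m. inner (X (s m)) u) \<longlonglongrightarrow> f u" for u
    using conv unfolding f_def by (simp add: convergent_LIMSEQ_iff)
  have "bounded_linear f"
  proof (rule bounded_linear_intro)
    fix u v :: 'h and c :: real
    show "f (u + v) = f u + f v"
      using LIMSEQ_unique[OF lim_f[of "u + v"]] tendsto_add[OF lim_f[of u] lim_f[of v]]
      by (simp add: inner_add)
    show "f (c *\<^sub>R u) = c *\<^sub>R f u"
      using LIMSEQ_unique[OF lim_f[of "c *\<^sub>R u"]] tendsto_mult[OF tendsto_const lim_f[of u]]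
      by simp
    show "norm (f u) \<le> norm u * B"
      using ip by (intro LIMSEQ_le_const2[OF tendsto_norm[OF lim_f[of u]]]) (auto simp: mult.commute)
  qed
  then obtain w where "\<forall>u. f u = inner w u" using riesz_representation by blast
  with lim_f have "weakly_converges (X \<circ> s) w" by (simp add: weakly_converges_def)
  then show ?thesis using that subseq_diagseq unfolding s_def by blast
qed

section \<open>Haugazeau iterations\<close>

lemma half_eq: "half x y = {w. inner (x - y) w \<le> inner (x - y) y}"
  unfolding half_def by (auto simp: inner_diff inner_commute)

lemma closed_half: "closed (half x y)"
  unfolding half_eq by (rule closed_halfspace_le)

lemma convex_half: "convex (half x y)"
  unfolding half_eq by (rule convex_halfspace_le)

text \<open>The angle at \<open>y\<close> is right or obtuse, so the cross term has the favourable
  sign. The bound on the iterates and the summability of the steps both come from this.\<close>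

lemma half_pythagoras:
  assumes "w \<in> half x y"
  shows "(norm (y - x))\<^sup>2 + (norm (w - y))\<^sup>2 \<le> (norm (w - x))\<^sup>2"
  using assms unfolding half_def power2_norm_eq_inner
  by (simp add: inner_diff inner_commute algebra_simps)

text \<open>Testing weak convergence against \<open>w - y\<close> itself and applying Cauchy-Schwarz
  bounds the squared norm of \<open>w - y\<close> by \<open>B * norm (w - y)\<close>.\<close>

lemma weak_limit_norm_le:
  assumes "weakly_converges X w" and bound: "\<And>n. norm (X n - y) \<le> B"
  shows "norm (w - y) \<le> B"
proof (cases "w = y")
  case False
  have "(\<lambda>n. inner (X n) (w - y) - inner y (w - y)) \<longlonglongrightarrow> inner w (w - y) - inner y (w - y)"
    using assms(1) unfolding weakly_converges_def
    by (intro tendsto_mult tendsto_diff tendsto_const) auto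
  moreover have "inner (X n) (w - y) - inner y (w - y) \<le> B * norm (w - y)" for n
  proof -
    have "inner (X n - y) (w - y) \<le> norm (X n - y) * norm (w - y)" by (rule norm_cauchy_schwarz)
    also have "\<dots> \<le> B * norm (w - y)" by (intro mult_right_mono bound) auto
    finally show ?thesis by (simp add: inner_diff)
  qed
  ultimately have "inner w (w - y) - inner y (w - y) \<le> B * norm (w - y)"
    by (intro LIMSEQ_le_const2[of _ "inner w (w - y) - inner y (w - y)"]) auto
  then have "norm (w - y) * norm (w - y) \<le> B * norm (w - y)"
    unfolding inner_diff_left[symmetric] power2_eq_square[symmetric] power2_norm_eq_inner .
  then show ?thesis using False by simp
qed (use order_trans[OF norm_ge_zero bound] in auto)

text \<open>Expanding about \<open>y\<close> bounds the squared distance of \<open>X n\<close> to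
  \<open>w\<close> by \<open>2 * inner (w - X n) (w - y)\<close>, which vanishes by weak
  convergence.\<close>

lemma weak_limit_norm_imp_tendsto:
  assumes "weakly_converges X w" and bound: "\<And>n. norm (X n - y) \<le> norm (w - y)"
  shows "X \<longlonglongrightarrow> w"
proof -
  have "(\<lambda>n. 2 * (inner w (w - y) - inner (X n) (w - y))) \<longlonglongrightarrow> 2 * (inner w (w - y) - inner w (w - y))"
    using assms(1) unfolding weakly_converges_def
    by (intro tendsto_mult tendsto_diff tendsto_const) auto
  moreover have "(norm (X n - w))\<^sup>2 \<le> 2 * (inner w (w - y) - inner (X n) (w - y))" for n
  proof -
    have "(norm (X n - y))\<^sup>2 \<le> (norm (w - y))\<^sup>2" by (intro power_mono bound) auto
    then show ?thesis
      unfolding power2_norm_eq_inner by (simp add: inner_diff inner_commute algebra_simps)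
  qed
  ultimately have "(\<lambda>n. (norm (X n - w))\<^sup>2) \<longlonglongrightarrow> 0"
    by (intro tendsto_sandwich[where f="\<lambda>_. 0" and g="\<lambda>n. (norm (X n - w))\<^sup>2"]) auto
  then have "(\<lambda>n. sqrt ((norm (X n - w))\<^sup>2)) \<longlonglongrightarrow> sqrt 0" by (rule tendsto_real_sqrt)
  then show ?thesis by (simp add: LIM_zero_iff tendsto_norm_zero_iff)
qed

text \<open>This isolates the geometry of a single sample path. All that is kept of the construction
  of \<open>r n\<close> is that \<open>Z\<close> lies in the half-space it defines.\<close>

locale haugazeau =
  fixes x r :: "nat \<Rightarrow> 'h::{real_inner,banach,second_countable_topology}" and Z :: "'h set"
  assumes closed: "closed Z" and convex: "convex Z" and nonempty: "Z \<noteq> {}"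
    and Z_half: "\<And>n. Z \<subseteq> half (x n) (r n)"
    and step: "\<And>n. x (Suc n) = Q (x 0) (x n) (r n)"
begin

text \<open>A point of \<open>Z\<close> lies in both half-spaces, which excludes the singleton
  branch of \<open>outer\<close>.\<close>

lemma Z_outer:
  assumes "Z \<subseteq> half (x 0) (x n)"
  shows "outer (x 0) (x n) (r n) = half (x 0) (x n) \<inter> half (x n) (r n)"
proof -
  have "half (x 0) (x n) \<inter> half (x n) (r n) \<noteq> {}"
    using Z_half[of n] assms nonempty by blast
  then show ?thesis by (simp add: outer_def)
qed

text \<open>\<open>x (Suc n)\<close> is the projection of \<open>x 0\<close> onto the intersection
  of the two half-spaces; the second claim is the variational inequality of that projection and
  drives the induction in \<open>Z_subset\<close>.\<close>

lemma step_proj: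
  assumes "Z \<subseteq> half (x 0) (x n)"
  shows "x (Suc n) \<in> half (x 0) (x n) \<inter> half (x n) (r n)"
    and "half (x 0) (x n) \<inter> half (x n) (r n) \<subseteq> half (x 0) (x (Suc n))"
proof -
  let ?C = "half (x 0) (x n) \<inter> half (x n) (r n)"
  have C: "closed ?C" "convex ?C" "?C \<noteq> {}"
    using Z_half[of n] assms nonempty
    by (blast intro: closed_Int convex_Int closed_half convex_half)+
  have eq: "x (Suc n) = proj ?C (x 0)"
    unfolding step Q_def Z_outer[OF assms] ..
  show "x (Suc n) \<in> ?C" unfolding eq by (rule proj_in[OF C])
  show "?C \<subseteq> half (x 0) (x (Suc n))"
    unfolding eq half_def[of "x 0" "proj ?C (x 0)"] using proj_inner_le[OF C(1,2)] by auto
qed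

lemma Z_subset: "Z \<subseteq> half (x 0) (x n)"
proof (induction n)
  case 0
  \<comment> \<open>\<open>half (x 0) (x 0)\<close> is the whole space, because its normal vector is
    zero.\<close>
  show ?case by (auto simp: half_def)
next
  case (Suc n)
  then show ?case using step_proj(2)[OF Suc] Z_half by blast
qed

lemma dist_le:
  assumes "z \<in> Z" shows "norm (x n - x 0) \<le> norm (z - x 0)"
proof -
  have "(norm (x n - x 0))\<^sup>2 + (norm (z - x n))\<^sup>2 \<le> (norm (z - x 0))\<^sup>2"
    using Z_subset assms by (intro half_pythagoras) blast
  then have "(norm (x n - x 0))\<^sup>2 \<le> (norm (z - x 0))\<^sup>2"
    using zero_le_power2[of "norm (z - x n)"] by linarith
  then show ?thesis by (rule power2_le_imp_le) simp
qed

text \<open>Applying \<open>half_pythagoras\<close> at \<open>x N\<close> and at \<open>r N\<close>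
  shows that the squared distance to \<open>x 0\<close> grows in each step by at least the squared
  length of \<open>r N - x N\<close>. The sum telescopes, and \<open>dist_le\<close> bounds the
  total.\<close>

lemma sum_r_le:
  assumes "z \<in> Z" shows "(\<Sum>n<N. (norm (r n - x n))\<^sup>2) \<le> (norm (z - x 0))\<^sup>2"
proof -
  have "(\<Sum>n<N. (norm (r n - x n))\<^sup>2) \<le> (norm (x N - x 0))\<^sup>2"
  proof (induction N)
    case (Suc N)
    have "(norm (x N - x 0))\<^sup>2 + (norm (x (Suc N) - x N))\<^sup>2 \<le> (norm (x (Suc N) - x 0))\<^sup>2"
      "(norm (r N - x N))\<^sup>2 + (norm (x (Suc N) - r N))\<^sup>2 \<le> (norm (x (Suc N) - x N))\<^sup>2"
      using step_proj(1)[OF Z_subset, of N] by (auto intro: half_pythagoras)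
    moreover have "0 \<le> (norm (x (Suc N) - r N))\<^sup>2" by simp
    ultimately show ?case using Suc unfolding sum.lessThan_Suc by linarith
  qed simp
  also have "\<dots> \<le> (norm (z - x 0))\<^sup>2" using dist_le[OF assms] by (intro power_mono) auto
  finally show ?thesis .
qed

text \<open>By weak lower semicontinuity of the norm, \<open>w\<close> is at least as close to
  \<open>x 0\<close> as any point of \<open>Z\<close>.\<close>

lemma weak_limit_eq:
  assumes "weakly_converges (x \<circ> s) w" "w \<in> Z"
  shows "w = proj Z (x 0)"
proof -
  have "norm (w - x 0) \<le> norm (y - x 0)" if "y \<in> Z" for y
    by (rule weak_limit_norm_le[OF assms(1)]) (use dist_le[OF that] in simp)
  then show ?thesis
    using assms(2) by (intro proj_eqI[symmetric] closed convex) (auto simp: dist_norm norm_minus_commute)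
qed

text \<open>A subsequence staying away from the projection would, being bounded, have a weakly
  convergent further subsequence. Its limit lies in \<open>Z\<close>, hence is the projection, and
  the norm bound makes the convergence strong, a contradiction.\<close>

lemma strong_convergence:
  assumes weak: "\<And>s w. strict_mono s \<Longrightarrow> weakly_converges (x \<circ> s) w \<Longrightarrow> w \<in> Z"
  shows "x \<longlonglongrightarrow> proj Z (x 0)"
proof -
  let ?z = "proj Z (x 0)"
  have zZ: "?z \<in> Z" by (rule proj_in[OF closed convex nonempty])
  have bd: "norm (x n) \<le> norm (x 0) + norm (?z - x 0)" for n
    using dist_le[OF zZ, of n] norm_triangle_sub[of "x n" "x 0"] by linarith
  show ?thesis
  proof (rule ccontr)
    assume "\<not> ?thesis"
    then obtain e where e: "0 < e" "\<exists>\<^sub>F n in sequentially. e \<le> dist (x n) ?z"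
      unfolding tendsto_iff not_all not_imp not_eventually not_less by blast
    then have "infinite {n. e \<le> dist (x n) ?z}"
      by (simp add: frequently_cofinite flip: cofinite_eq_sequentially)
    from infinite_enumerate[OF this]
    obtain s :: "nat \<Rightarrow> nat" where s: "strict_mono s" "\<And>n. e \<le> dist (x (s n)) ?z" by auto
    obtain s' w where s': "strict_mono s'" "weakly_converges ((x \<circ> s) \<circ> s') w"
      using bounded_weakly_convergent_subseq[of "x \<circ> s" "norm (x 0) + norm (?z - x 0)"] bd
      unfolding comp_apply by blast
    then have weakly: "weakly_converges (x \<circ> (s \<circ> s')) w" by (simp add: o_assoc)
    then have "w = ?z"
      using weak weak_limit_eq strict_mono_o[OF s(1) s'(1)] by blast
    with weakly have "(x \<circ> (s \<circ> s')) \<longlonglongrightarrow> ?z"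
      using dist_le[OF zZ] by (intro weak_limit_norm_imp_tendsto[where y="x 0"]) auto
    then have "eventually (\<lambda>n. dist (x (s (s' n))) ?z < e) sequentially"
      using e(1) by (auto dest!: tendstoD)
    then obtain n where "dist (x (s (s' n))) ?z < e" by (auto simp: eventually_sequentially)
    then show False using s(2) by (meson not_le)
  qed
qed

end

section \<open>Convex combinations and the extrapolated step\<close>

lemma norm_convex_combination_square_le:
  fixes u :: "'i \<Rightarrow> 'h::real_inner"
  assumes "finite I" "\<And>i. i \<in> I \<Longrightarrow> 0 \<le> c i" "sum c I = 1"
  shows "(norm (\<Sum>i\<in>I. c i *\<^sub>R u i))\<^sup>2 \<le> (\<Sum>i\<in>I. c i * (norm (u i))\<^sup>2)"
proof -
  define s where "s = (\<Sum>i\<in>I. c i *\<^sub>R u i)"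
  \<comment> \<open>This is the weighted variance about the mean \<open>s\<close>; expanding it
    gives the claim.\<close>
  have "0 \<le> (\<Sum>i\<in>I. c i * (norm (u i - s))\<^sup>2)"
    using assms by (intro sum_nonneg) auto
  also have "\<dots> = (\<Sum>i\<in>I. c i * (norm (u i))\<^sup>2 - 2 * inner (c i *\<^sub>R u i) s + c i * inner s s)"
    unfolding power2_norm_eq_inner
    by (intro sum.cong) (simp_all add: inner_diff inner_commute algebra_simps)
  also have "\<dots> = (\<Sum>i\<in>I. c i * (norm (u i))\<^sup>2) - 2 * inner s s + inner s s"
    using assms(3)
    by (simp add: sum.distrib sum_subtractf s_def inner_sum_left flip: sum_distrib_left sum_distrib_right)
  finally show ?thesis by (simp add: s_def power2_norm_eq_inner)
qed

text \<open>Averaging the inequalities for the \<open>p i\<close> gives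
  \<open>S \<le> inner (z - x) (pbar - x)\<close>, and convexity of the squared norm gives
  \<open>L \<ge> 1\<close> when \<open>pbar \<noteq> x\<close>. Then
  \<open>(norm (a - x))\<^sup>2 = L * S\<close> lies between \<open>S\<close> and
  \<open>inner (z - x) (a - x)\<close>. Relaxation by \<open>l \<le> 1\<close> keeps
  \<open>z\<close> in the half-space and costs at most the factor
  \<open>\<epsilon>\<^sup>2\<close>.\<close>

lemma relaxed_extrapolation:
  fixes x z :: "'h::real_inner" and p :: "'i \<Rightarrow> 'h"
  assumes I: "finite I" and c: "\<And>i. i \<in> I \<Longrightarrow> 0 \<le> c i" "sum c I = 1"
    and z: "\<And>i. i \<in> I \<Longrightarrow> (norm (p i - x))\<^sup>2 \<le> inner (z - x) (p i - x)"
    and pbar: "pbar = (\<Sum>i\<in>I. c i *\<^sub>R p i)"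
    and S: "S = (\<Sum>i\<in>I. c i * (norm (p i - x))\<^sup>2)"
    and L: "L = (S + of_bool (pbar = x)) / ((norm (pbar - x))\<^sup>2 + of_bool (pbar = x))"
    and a: "a = x + L *\<^sub>R (pbar - x)"
    and l: "0 < \<epsilon>" "\<epsilon> \<le> l" "l \<le> 1"
    and r: "r = x + l *\<^sub>R (a - x)"
  shows "z \<in> half x r" and "\<epsilon>\<^sup>2 * S \<le> (norm (r - x))\<^sup>2"
proof -
  have pbar_x: "pbar - x = (\<Sum>i\<in>I. c i *\<^sub>R (p i - x))"
    by (simp add: pbar scaleR_diff_right sum_subtractf c(2) flip: scaleR_left.sum)
  have S0: "0 \<le> S" unfolding S using c by (intro sum_nonneg) auto
  have S_le: "S \<le> inner (z - x) (pbar - x)"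
    unfolding S pbar_x inner_sum_right using c z by (auto intro!: sum_mono mult_left_mono)
  have le_S: "(norm (pbar - x))\<^sup>2 \<le> S"
    unfolding S pbar_x by (rule norm_convex_combination_square_le[OF I c])
  have "(norm (a - x))\<^sup>2 \<le> inner (z - x) (a - x) \<and> S \<le> (norm (a - x))\<^sup>2"
  proof (cases "pbar = x")
    \<comment> \<open>Here \<open>a = x\<close> whatever the value of \<open>L\<close>, and
      \<open>S_le\<close> forces \<open>S \<le> 0\<close>.\<close>
    case True
    then show ?thesis using S_le by (simp add: a)
  next
    case False
    define N where "N = (norm (pbar - x))\<^sup>2"
    have N0: "0 < N" using False by (simp add: N_def)
    have L': "L = S / N" using False by (simp add: L N_def)
    have "(norm (a - x))\<^sup>2 = L\<^sup>2 * N" by (simp add: a power_mult_distrib N_def)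
    also have "\<dots> = L * S" using N0 by (simp add: L' power2_eq_square)
    finally have na: "(norm (a - x))\<^sup>2 = L * S" .
    have "L * S \<le> L * inner (z - x) (pbar - x)"
      using S_le S0 N0 by (intro mult_left_mono) (auto simp: L')
    moreover have "1 * S \<le> L * S"
      using le_S N0 S0 by (intro mult_right_mono) (auto simp: L' N_def[symmetric])
    ultimately show ?thesis unfolding na by (simp add: a)
  qed
  then have za: "(norm (a - x))\<^sup>2 \<le> inner (z - x) (a - x)" and Sa: "S \<le> (norm (a - x))\<^sup>2" by auto
  have "l * (l * (norm (a - x))\<^sup>2) \<le> l * (1 * inner (z - x) (a - x))"
    using za l by (intro mult_left_mono mult_mono) auto
  then show "z \<in> half x r"
    unfolding half_def power2_norm_eq_inner
    by (simp add: r inner_diff inner_add inner_commute algebra_simps)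
  have "\<epsilon>\<^sup>2 * S \<le> l\<^sup>2 * (norm (a - x))\<^sup>2"
    using l Sa S0 by (intro mult_mono power_mono) auto
  then show "\<epsilon>\<^sup>2 * S \<le> (norm (r - x))\<^sup>2"
    using l by (simp add: r power_mult_distrib)
qed

text \<open>An index attaining the maximum has weight at least \<open>\<delta>\<close> and a value
  dominating \<open>g j\<close>, so its term alone suffices.\<close>

lemma weighted_sum_square_ge:
  fixes c g :: "'i \<Rightarrow> real"
  assumes "finite I" "j \<in> I" "0 \<le> \<delta>" and c: "\<And>i. i \<in> I \<Longrightarrow> 0 \<le> c i" and g: "\<And>i. i \<in> I \<Longrightarrow> 0 \<le> g i"
    and max: "\<And>i. i \<in> I \<Longrightarrow> \<delta> * of_bool (g i = Max (g ` I)) \<le> c i"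
  shows "\<delta> * (g j)\<^sup>2 \<le> (\<Sum>i\<in>I. c i * (g i)\<^sup>2)"
proof -
  have "Max (g ` I) \<in> g ` I" using assms(1,2) by (intro Max_in) auto
  then obtain i where i: "i \<in> I" "g i = Max (g ` I)" by force
  have "g j \<le> g i" unfolding i(2) using assms(1,2) by (intro Max_ge) auto
  then have "\<delta> * (g j)\<^sup>2 \<le> c i * (g i)\<^sup>2"
    using max[OF i(1)] i assms(2,3) g by (intro mult_mono power_mono) auto
  also have "\<dots> \<le> (\<Sum>i\<in>I. c i * (g i)\<^sup>2)"
    using assms(1) i(1) c by (intro member_le_sum) auto
  finally show ?thesis .
qed

section \<open>Random fixed point sets and random sampling\<close>

text \<open>Expanding \<open>T x - z\<close> about \<open>x\<close> linearizes the condition in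
  \<open>z\<close>: it becomes \<open>z \<in> half x (T x)\<close>.\<close>

lemma firmly_quasinonexpansive_inner:
  assumes "firmly_quasinonexpansive T" "z \<in> Fix T"
  shows "(norm (T x - x))\<^sup>2 \<le> inner (z - x) (T x - x)"
proof -
  have "(norm (T x - z))\<^sup>2 + (norm (T x - x))\<^sup>2 \<le> (norm (x - z))\<^sup>2"
    using assms unfolding firmly_quasinonexpansive_def by blast
  then show ?thesis
    unfolding power2_norm_eq_inner by (simp add: inner_diff inner_commute algebra_simps)
qed

text \<open>A point \<open>z\<close> of the intersection is fixed already because of the half-space
  belonging to \<open>x = z\<close>. Since \<open>T\<close> may be discontinuous, closedness and
  convexity of \<open>Fix T\<close> are read off from this form.\<close>

lemma Fix_eq_Inter_halfspaces:
  fixes T :: "'h::real_inner \<Rightarrow> 'h"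
  assumes "firmly_quasinonexpansive T"
  shows "Fix T = (\<Inter>x. {z. inner (T x - x) z \<ge> (norm (T x - x))\<^sup>2 + inner (T x - x) x})"
proof (intro set_eqI iffI)
  fix z assume "z \<in> Fix T"
  then show "z \<in> (\<Inter>x. {z. inner (T x - x) z \<ge> (norm (T x - x))\<^sup>2 + inner (T x - x) x})"
    using firmly_quasinonexpansive_inner[OF assms, of z]
    by (simp add: inner_diff inner_commute algebra_simps)
next
  fix z assume "z \<in> (\<Inter>x. {z. inner (T x - x) z \<ge> (norm (T x - x))\<^sup>2 + inner (T x - x) x})"
  then have "(norm (T z - z))\<^sup>2 + inner (T z - z) z \<le> inner (T z - z) z" by blast
  then show "z \<in> Fix T" by (simp add: Fix_def)
qed

lemma
  fixes T :: "'h::real_inner \<Rightarrow> 'h"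
  assumes "firmly_quasinonexpansive T"
  shows closed_Fix: "closed (Fix T)" and convex_Fix: "convex (Fix T)"
  unfolding Fix_eq_Inter_halfspaces[OF assms]
  by (intro closed_INT convex_INT closed_halfspace_ge convex_halfspace_ge ballI)+

text \<open>A convergent sequence brings in only countably many exceptional null sets.\<close>

lemma closed_AE_mem:
  fixes F :: "'a \<Rightarrow> 'h::metric_space set"
  assumes "\<And>\<omega>. \<omega> \<in> space P \<Longrightarrow> closed (F \<omega>)"
  shows "closed {z. AE \<omega> in P. z \<in> F \<omega>}"
  unfolding closed_sequential_limits
proof (intro allI impI)
  fix y l assume "(\<forall>n. y n \<in> {z. AE \<omega> in P. z \<in> F \<omega>}) \<and> y \<longlonglongrightarrow> l"
  then have "AE \<omega> in P. \<forall>n. y n \<in> F \<omega>" and l: "y \<longlonglongrightarrow> l" by (auto simp: AE_all_countable)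
  then have "AE \<omega> in P. l \<in> F \<omega>"
    using AE_space assms closed_sequentially[OF _ _ l] by (auto elim!: AE_mp)
  then show "l \<in> {z. AE \<omega> in P. z \<in> F \<omega>}" by simp
qed

lemma convex_AE_mem:
  assumes "\<And>\<omega>. \<omega> \<in> space P \<Longrightarrow> convex (F \<omega>)"
  shows "convex {z. AE \<omega> in P. z \<in> F \<omega>}"
proof (rule convexI)
  fix y z and u v :: real
  assume "y \<in> {z. AE \<omega> in P. z \<in> F \<omega>}" "z \<in> {z. AE \<omega> in P. z \<in> F \<omega>}" "0 \<le> u" "0 \<le> v" "u + v = 1"
  moreover from this have "AE \<omega> in P. y \<in> F \<omega>" "AE \<omega> in P. z \<in> F \<omega>" by auto
  then have "AE \<omega> in P. u *\<^sub>R y + v *\<^sub>R z \<in> F \<omega>"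
    using AE_space by eventually_elim (use calculation assms in \<open>auto intro: convexD\<close>)
  then show "u *\<^sub>R y + v *\<^sub>R z \<in> {z. AE \<omega> in P. z \<in> F \<omega>}" by simp
qed

text \<open>The exceptional null set depends on \<open>z\<close>. A countable dense subset of
  \<open>Z\<close> leaves countably many of them, and closedness of \<open>F \<omega>\<close>
  recovers the remaining points.\<close>

lemma AE_subset_of_separable:
  fixes F :: "'a \<Rightarrow> 'h::{metric_space, second_countable_topology} set"
  assumes "\<And>\<omega>. \<omega> \<in> space P \<Longrightarrow> closed (F \<omega>)" and "\<And>z. z \<in> Z \<Longrightarrow> AE \<omega> in P. z \<in> F \<omega>"
  shows "AE \<omega> in P. Z \<subseteq> F \<omega>"
proof -
  obtain D where D: "countable D" "D \<subseteq> Z" "Z \<subseteq> closure D" using separable by metis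
  then have "AE \<omega> in P. \<forall>z\<in>D. z \<in> F \<omega>" using assms(2) by (subst AE_ball_countable) auto
  then show ?thesis
    using AE_space
  proof eventually_elim
    case (elim \<omega>)
    then have "closure D \<subseteq> F \<omega>" using assms(1) by (intro closure_minimal) auto
    then show ?case using D(3) by blast
  qed
qed

section \<open>Copies, independence and joint laws\<close>

context prob_space
begin

lemma distr_copy:
  assumes "is_copy M K y x" "x \<in> measurable M K"
  shows "distr M K y = distr M K x"
  using assms unfolding is_copy_def by (intro measure_eqI) (auto simp: emeasure_distr emeasure_eq_measure)

text \<open>\<open>indep_set\<close> requires both families to consist of events; this is where
  measurability of the iterates comes from.\<close>

lemma measurable_sigma_upto:
  fixes X :: "nat \<Rightarrow> 'a \<Rightarrow> 'h::topological_space"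
  assumes "indep_set (sigma_rv M K y) (sigma_upto M X n)" "j \<le> n"
  shows "X j \<in> borel_measurable M"
proof (rule measurableI)
  fix S :: "'h set" assume "S \<in> sets borel"
  then have "X j -` S \<inter> space M \<in> sigma_upto M X n"
    using assms(2) unfolding sigma_upto_def sigma_rv_def by (intro sigma_sets.Basic) blast
  moreover have "sigma_upto M X n \<subseteq> events"
    using assms(1) unfolding indep_set_def indep_sets_def by (auto split: bool.splits)
  ultimately show "X j -` S \<inter> space M \<in> events" by blast
qed simp

text \<open>A product of sigma-finite measures is determined by its values on rectangles, where
  independence gives exactly the product formula.\<close>

lemma distr_pair_indep:
  fixes X :: "nat \<Rightarrow> 'a \<Rightarrow> 'h::topological_space"
  assumes indep: "indep_set (sigma_rv M K y) (sigma_upto M X n)" and y: "y \<in> measurable M K"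
  shows "distr M (K \<Otimes>\<^sub>M borel) (\<lambda>\<omega>. (y \<omega>, X n \<omega>)) = distr M K y \<Otimes>\<^sub>M distr M borel (X n)"
proof -
  have X [measurable]: "X n \<in> borel_measurable M" by (rule measurable_sigma_upto[OF indep order_refl])
  note [measurable] = y
  interpret Y: prob_space "distr M K y" by (rule prob_space_distr) simp
  interpret X: prob_space "distr M borel (X n)" by (rule prob_space_distr) simp
  show ?thesis
  proof (rule pair_measure_eqI[symmetric])
    fix A B assume "A \<in> sets (distr M K y)" "B \<in> sets (distr M borel (X n))"
    then have A [measurable]: "A \<in> sets K" and B [measurable]: "B \<in> sets borel" by auto
    have "y -` A \<inter> space M \<in> sigma_rv M K y" using A unfolding sigma_rv_def by blast
    moreover have "X n -` B \<inter> space M \<in> sigma_upto M X n"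
      using B unfolding sigma_upto_def sigma_rv_def by (intro sigma_sets.Basic) blast
    ultimately have "prob ((y -` A \<inter> space M) \<inter> (X n -` B \<inter> space M)) =
        prob (y -` A \<inter> space M) * prob (X n -` B \<inter> space M)"
      using indep by (intro indep_setD)
    moreover have "(y -` A \<inter> space M) \<inter> (X n -` B \<inter> space M) =
        (\<lambda>\<omega>. (y \<omega>, X n \<omega>)) -` (A \<times> B) \<inter> space M" by auto
    ultimately show "emeasure (distr M K y) A * emeasure (distr M borel (X n)) B =
        emeasure (distr M (K \<Otimes>\<^sub>M borel) (\<lambda>\<omega>. (y \<omega>, X n \<omega>))) (A \<times> B)"
      by (simp add: emeasure_distr emeasure_eq_measure ennreal_mult)
  qed (auto intro: Y.sigma_finite_measure_axioms X.sigma_finite_measure_axioms)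
qed

text \<open>By Tonelli, each term of the sum is the integral of \<open>f\<close> over \<open>\<mu> \<otimes> X\<^sub>n\<close>, so that the random
  index may be replaced by an index that does not depend on \<open>n\<close>.\<close>

lemma AE_independent_sampling:
  fixes X :: "nat \<Rightarrow> 'a \<Rightarrow> 'h::topological_space" and f :: "'k \<times> 'h \<Rightarrow> ennreal"
  assumes \<mu>: "prob_space \<mu>" "sets \<mu> = sets K"
    and y: "\<And>n. y n \<in> measurable M K" and X: "\<And>n. X n \<in> borel_measurable M"
    and f: "f \<in> borel_measurable (K \<Otimes>\<^sub>M borel)"
    and joint: "\<And>n. distr M (K \<Otimes>\<^sub>M borel) (\<lambda>\<omega>. (y n \<omega>, X n \<omega>)) = \<mu> \<Otimes>\<^sub>M distr M borel (X n)"
    and fin: "(\<Sum>n. \<integral>\<^sup>+\<omega>. f (y n \<omega>, X n \<omega>) \<partial>M) \<noteq> \<infinity>"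
  shows "AE \<omega> in M. AE \<kappa> in \<mu>. (\<Sum>n. f (\<kappa>, X n \<omega>)) \<noteq> \<infinity>"
proof -
  note [measurable] = y X f
  note [measurable_cong] = \<mu>(2)
  interpret \<mu>: prob_space \<mu> by fact
  have eq: "(\<integral>\<^sup>+\<omega>. f (y n \<omega>, X n \<omega>) \<partial>M) = (\<integral>\<^sup>+\<omega>. \<integral>\<^sup>+\<kappa>. f (\<kappa>, X n \<omega>) \<partial>\<mu> \<partial>M)" for n
  proof -
    interpret N: prob_space "distr M borel (X n)" by (rule prob_space_distr) simp
    interpret pair_sigma_finite \<mu> "distr M borel (X n)" ..
    have "(\<integral>\<^sup>+\<omega>. f (y n \<omega>, X n \<omega>) \<partial>M) = integral\<^sup>N (\<mu> \<Otimes>\<^sub>M distr M borel (X n)) f"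
      unfolding joint[symmetric] by (subst nn_integral_distr) simp_all
    also have "\<dots> = (\<integral>\<^sup>+u. \<integral>\<^sup>+\<kappa>. f (\<kappa>, u) \<partial>\<mu> \<partial>distr M borel (X n))"
      by (subst nn_integral_snd[symmetric]) simp_all
    also have "\<dots> = (\<integral>\<^sup>+\<omega>. \<integral>\<^sup>+\<kappa>. f (\<kappa>, X n \<omega>) \<partial>\<mu> \<partial>M)"
      by (subst nn_integral_distr) simp_all
    finally show ?thesis .
  qed
  have "(\<integral>\<^sup>+\<omega>. \<integral>\<^sup>+\<kappa>. (\<Sum>n. f (\<kappa>, X n \<omega>)) \<partial>\<mu> \<partial>M) = (\<Sum>n. \<integral>\<^sup>+\<omega>. \<integral>\<^sup>+\<kappa>. f (\<kappa>, X n \<omega>) \<partial>\<mu> \<partial>M)"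
  proof -
    have "(\<integral>\<^sup>+\<kappa>. (\<Sum>n. f (\<kappa>, X n \<omega>)) \<partial>\<mu>) = (\<Sum>n. \<integral>\<^sup>+\<kappa>. f (\<kappa>, X n \<omega>) \<partial>\<mu>)" if "\<omega> \<in> space M" for \<omega>
      using that by (intro nn_integral_suminf) measurable
    then have "(\<integral>\<^sup>+\<omega>. \<integral>\<^sup>+\<kappa>. (\<Sum>n. f (\<kappa>, X n \<omega>)) \<partial>\<mu> \<partial>M) = (\<integral>\<^sup>+\<omega>. (\<Sum>n. \<integral>\<^sup>+\<kappa>. f (\<kappa>, X n \<omega>) \<partial>\<mu>) \<partial>M)"
      by (intro nn_integral_cong) simp
    also have "\<dots> = (\<Sum>n. \<integral>\<^sup>+\<omega>. \<integral>\<^sup>+\<kappa>. f (\<kappa>, X n \<omega>) \<partial>\<mu> \<partial>M)"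
      by (intro nn_integral_suminf) measurable
    finally show ?thesis .
  qed
  then have "(\<integral>\<^sup>+\<omega>. \<integral>\<^sup>+\<kappa>. (\<Sum>n. f (\<kappa>, X n \<omega>)) \<partial>\<mu> \<partial>M) \<noteq> \<infinity>"
    using fin by (simp add: eq)
  then have "AE \<omega> in M. (\<integral>\<^sup>+\<kappa>. (\<Sum>n. f (\<kappa>, X n \<omega>)) \<partial>\<mu>) \<noteq> \<infinity>"
    by (intro nn_integral_PInf_AE) measurable
  then show ?thesis
    using AE_space
  proof eventually_elim
    case (elim \<omega>)
    then show ?case by (intro nn_integral_PInf_AE) measurable
  qed
qed

end

section \<open>Square-integrable maps\<close>

lemma in_L2_dominated:
  assumes "in_L2 P g" "f \<in> borel_measurable P" "AE \<omega> in P. norm (f \<omega>) \<le> norm (g \<omega>)"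
  shows "in_L2 P f"
proof -
  note [measurable] = assms(2)
  have "integrable P (\<lambda>\<omega>. (norm (f \<omega>))\<^sup>2)"
  proof (rule Bochner_Integration.integrable_bound)
    show "integrable P (\<lambda>\<omega>. (norm (g \<omega>))\<^sup>2)" using assms(1) by (simp add: in_L2_def)
    show "AE \<omega> in P. norm ((norm (f \<omega>))\<^sup>2) \<le> norm ((norm (g \<omega>))\<^sup>2)"
      using assms(3) by eventually_elim (simp add: power_mono)
  qed measurable
  then show ?thesis using assms(2) by (simp add: in_L2_def)
qed

lemma in_L2_add:
  fixes f g :: "'a \<Rightarrow> 'h::{real_inner, second_countable_topology}"
  assumes "in_L2 P f" "in_L2 P g"
  shows "in_L2 P (\<lambda>\<omega>. f \<omega> + g \<omega>)"
proof -
  have [measurable]: "f \<in> borel_measurable P" "g \<in> borel_measurable P"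
    using assms by (simp_all add: in_L2_def)
  \<comment> \<open>The parallelogram identity with the square of
    \<open>norm (f \<omega> - g \<omega>)\<close> discarded.\<close>
  have bound: "(norm (f \<omega> + g \<omega>))\<^sup>2 \<le> 2 * (norm (f \<omega>))\<^sup>2 + 2 * (norm (g \<omega>))\<^sup>2" for \<omega>
    using zero_le_power2[of "norm (f \<omega> - g \<omega>)"] unfolding power2_norm_eq_inner
    by (simp add: inner_diff inner_add inner_commute algebra_simps)
  have "integrable P (\<lambda>\<omega>. (norm (f \<omega> + g \<omega>))\<^sup>2)"
  proof (rule Bochner_Integration.integrable_bound)
    show "integrable P (\<lambda>\<omega>. 2 * (norm (f \<omega>))\<^sup>2 + 2 * (norm (g \<omega>))\<^sup>2)"
      using assms unfolding in_L2_def
      by (intro Bochner_Integration.integrable_add integrable_mult_right) simp_all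
    show "AE \<omega> in P. norm ((norm (f \<omega> + g \<omega>))\<^sup>2) \<le> norm (2 * (norm (f \<omega>))\<^sup>2 + 2 * (norm (g \<omega>))\<^sup>2)"
      using bound by simp
  qed measurable
  then show ?thesis by (simp add: in_L2_def)
qed

section \<open>The convergence theorem\<close>

theorem theorem4p3:
  fixes P :: "'a measure"
    and K :: "'k measure"
    and T :: "'k \<Rightarrow> 'h::{real_inner, banach, second_countable_topology} \<Rightarrow> 'h"
    and k :: "'a \<Rightarrow> 'k"
    and Z :: "'h set"
    and M :: nat
    and \<delta> \<epsilon> :: real
    and x :: "nat \<Rightarrow> 'a \<Rightarrow> 'h"
    and kk :: "nat \<Rightarrow> nat \<Rightarrow> 'a \<Rightarrow> 'k"
    and p :: "nat \<Rightarrow> nat \<Rightarrow> 'a \<Rightarrow> 'h"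
    and \<beta> :: "nat \<Rightarrow> nat \<Rightarrow> 'a \<Rightarrow> real"
    and pbar a r :: "nat \<Rightarrow> 'a \<Rightarrow> 'h"
    and L lam :: "nat \<Rightarrow> 'a \<Rightarrow> real"
  assumes "prob_space P" and "complete_measure P"
    and "\<And>\<kappa>. \<kappa> \<in> space K \<Longrightarrow> firmly_quasinonexpansive (T \<kappa>)"
    and "(\<lambda>(\<kappa>, u). T \<kappa> u) \<in> measurable (K \<Otimes>\<^sub>M borel) borel"
    and "\<And>\<kappa>. \<kappa> \<in> space K \<Longrightarrow> demiclosed_at (\<lambda>u. u - T \<kappa> u) 0"
    and "k \<in> measurable P K"
    and "Z = {z. AE \<omega> in P. z \<in> Fix (T (k \<omega>))}" and "Z \<noteq> {}"
    and "in_L2 P (x 0)"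
    and "M > 0" and "0 < \<delta>" and "\<delta> < 1 / real M" and "0 < \<epsilon>" and "\<epsilon> < 1"
    and "\<And>n i. i \<in> {1..M} \<Longrightarrow> is_copy P K (kk i n) k"
    and "\<And>n i. i \<in> {1..M} \<Longrightarrow>
           prob_space.indep_set P (sigma_rv P K (kk i n)) (sigma_upto P x n)"
    and "\<And>n i \<omega>. i \<in> {1..M} \<Longrightarrow> \<omega> \<in> space P \<Longrightarrow> p i n \<omega> = T (kk i n \<omega>) (x n \<omega>)"
    and "\<And>n i. i \<in> {1..M} \<Longrightarrow> \<beta> i n \<in> borel_measurable P"
    and "\<And>n i \<omega>. i \<in> {1..M} \<Longrightarrow> \<omega> \<in> space P \<Longrightarrow> \<beta> i n \<omega> \<in> {0..1}"
    and "\<And>n. AE \<omega> in P. (\<Sum>i=1..M. \<beta> i n \<omega>) = 1"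
    and "\<And>n i. i \<in> {1..M} \<Longrightarrow> AE \<omega> in P. \<beta> i n \<omega> \<ge>
           \<delta> * of_bool (norm (p i n \<omega> - x n \<omega>) = Max ((\<lambda>j. norm (p j n \<omega> - x n \<omega>)) ` {1..M}))"
    and "\<And>n \<omega>. \<omega> \<in> space P \<Longrightarrow> pbar n \<omega> = (\<Sum>i=1..M. \<beta> i n \<omega> *\<^sub>R p i n \<omega>)"
    and "\<And>n \<omega>. \<omega> \<in> space P \<Longrightarrow> L n \<omega> =
           ((\<Sum>i=1..M. \<beta> i n \<omega> * (norm (p i n \<omega> - x n \<omega>))\<^sup>2) + of_bool (pbar n \<omega> = x n \<omega>)) /
           ((norm (pbar n \<omega> - x n \<omega>))\<^sup>2 + of_bool (pbar n \<omega> = x n \<omega>))"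
    and "\<And>n \<omega>. \<omega> \<in> space P \<Longrightarrow> a n \<omega> = x n \<omega> + L n \<omega> *\<^sub>R (pbar n \<omega> - x n \<omega>)"
    and "\<And>n. lam n \<in> borel_measurable P" and "\<And>n. AE \<omega> in P. lam n \<omega> \<in> {\<epsilon>..1}"
    and "\<And>n \<omega>. \<omega> \<in> space P \<Longrightarrow> r n \<omega> = x n \<omega> + lam n \<omega> *\<^sub>R (a n \<omega> - x n \<omega>)"
    and "\<And>n. AE \<omega> in P. x (Suc n) \<omega> = Q (x 0 \<omega>) (x n \<omega>) (r n \<omega>)"
  shows "(AE \<omega> in P. (\<lambda>n. x n \<omega>) \<longlonglongrightarrow> proj Z (x 0 \<omega>)) \<and>
         converges_in_L2 P x (\<lambda>\<omega>. proj Z (x 0 \<omega>))"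
proof -
  interpret prob_space P by fact
  \<comment> \<open>Passing to the law of \<open>k\<close> separates the operator index from
    \<open>\<omega>\<close>, so that one fixed \<open>\<kappa>\<close> can be tested against a whole
    path.\<close>
  define \<mu> where "\<mu> = distr P K k"
  have \<mu>: "prob_space \<mu>" "sets \<mu> = sets K" "space \<mu> = space K"
    unfolding \<mu>_def using assms(6) by (auto intro: prob_space_distr)
  \<comment> \<open>It suffices to follow the displacements of the first sampled operator, since
    each \<open>kk i n\<close> has law \<open>\<mu>\<close>.\<close>
  have one: "1 \<in> {1..M}" using assms(10) by auto
  have kk: "kk i n \<in> measurable P K" "distr P K (kk i n) = \<mu>" if "i \<in> {1..M}" for i n
    using assms(15)[OF that] distr_copy[OF assms(15)[OF that] assms(6)]
    by (auto simp: \<mu>_def is_copy_def)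
  have x_meas [measurable]: "x n \<in> borel_measurable P" for n
    using measurable_sigma_upto[OF assms(16)[OF one]] by blast

  \<comment> \<open>The set \<open>Z\<close> and the sampled fixed point sets\<close>
  have Fix_closed: "closed (Fix (T \<kappa>))" and Fix_convex: "convex (Fix (T \<kappa>))" if "\<kappa> \<in> space K" for \<kappa>
    using assms(3)[OF that] by (rule closed_Fix convex_Fix)+
  have k_space: "k \<omega> \<in> space K" if "\<omega> \<in> space P" for \<omega>
    using measurable_space[OF assms(6) that] .
  have Z: "closed Z" "convex Z"
    unfolding assms(7) using Fix_closed Fix_convex k_space
    by (auto intro: closed_AE_mem convex_AE_mem)
  \<comment> \<open>The indices fixing \<open>z\<close> form the preimage of a singleton under a
    measurable map, so the almost sure statement transfers from \<open>k\<close> to its law.\<close>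
  have Z_iff: "z \<in> Z \<longleftrightarrow> (AE \<kappa> in \<mu>. z \<in> Fix (T \<kappa>))" for z
  proof -
    have "(\<lambda>\<kappa>. T \<kappa> z) \<in> borel_measurable K"
      using measurable_compose[OF measurable_Pair[OF measurable_ident_sets[OF refl] measurable_const] assms(4)]
      by simp
    then have "(\<lambda>\<kappa>. T \<kappa> z) -` {z} \<inter> space K \<in> sets K"
      by (rule measurable_sets) simp
    also have "(\<lambda>\<kappa>. T \<kappa> z) -` {z} \<inter> space K = {\<kappa> \<in> space K. z \<in> Fix (T \<kappa>)}"
      by (auto simp: Fix_def)
    finally show ?thesis unfolding \<mu>_def assms(7) using AE_distr_iff[OF assms(6)] by simp
  qed
  have Z_\<mu>: "AE \<kappa> in \<mu>. Z \<subseteq> Fix (T \<kappa>)"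
    using Z_iff Fix_closed by (intro AE_subset_of_separable) (auto simp: \<mu>(3))
  \<comment> \<open>\<open>Z_\<mu>\<close> pulls back along each \<open>kk i n\<close> because its
    law is \<open>\<mu>\<close>, and only countably many pairs of indices occur.\<close>
  have Z_kk: "AE \<omega> in P. \<forall>n. \<forall>i\<in>{1..M}. Z \<subseteq> Fix (T (kk i n \<omega>))"
    unfolding AE_all_countable
  proof (intro allI AE_finite_allI)
    fix i n assume i: "i \<in> {1..M}"
    show "AE \<omega> in P. Z \<subseteq> Fix (T (kk i n \<omega>))"
      using AE_distrD[OF kk(1)[OF i], where P="\<lambda>\<kappa>. Z \<subseteq> Fix (T \<kappa>)"] Z_\<mu> unfolding kk(2)[OF i] by blast
  qed simp

  \<comment> \<open>Pathwise estimates\<close>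
  have \<delta>\<epsilon>: "0 < \<epsilon>\<^sup>2 * \<delta>" using assms(11,13) by simp
  \<comment> \<open>The factor \<open>\<epsilon>\<^sup>2\<close> accounts for the relaxation, and
    \<open>\<delta>\<close> is the least weight of a maximal displacement.\<close>
  have AE_step: "AE \<omega> in P. haugazeau (\<lambda>n. x n \<omega>) (\<lambda>n. r n \<omega>) Z \<and>
      (\<forall>n. \<epsilon>\<^sup>2 * \<delta> * (norm (p 1 n \<omega> - x n \<omega>))\<^sup>2 \<le> (norm (r n \<omega> - x n \<omega>))\<^sup>2)"
  proof -
    have "AE \<omega> in P. \<forall>n. (\<Sum>i=1..M. \<beta> i n \<omega>) = 1"
      and "AE \<omega> in P. \<forall>n. lam n \<omega> \<in> {\<epsilon>..1}"
      and "AE \<omega> in P. \<forall>n. x (Suc n) \<omega> = Q (x 0 \<omega>) (x n \<omega>) (r n \<omega>)"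
      using assms(20,26,28) by (simp_all add: AE_all_countable)
    moreover have "AE \<omega> in P. \<forall>n. \<forall>i\<in>{1..M}. \<beta> i n \<omega> \<ge>
        \<delta> * of_bool (norm (p i n \<omega> - x n \<omega>) = Max ((\<lambda>j. norm (p j n \<omega> - x n \<omega>)) ` {1..M}))"
      unfolding AE_all_countable using assms(21) by (intro allI AE_finite_allI) auto
    ultimately show ?thesis using Z_kk AE_space
    proof eventually_elim
      case (elim \<omega>)
      have \<omega>: "\<omega> \<in> space P" by (rule elim(6))
      have step: "Z \<subseteq> half (x n \<omega>) (r n \<omega>)"
        "\<epsilon>\<^sup>2 * \<delta> * (norm (p 1 n \<omega> - x n \<omega>))\<^sup>2 \<le> (norm (r n \<omega> - x n \<omega>))\<^sup>2" for n
      proof -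
        define S where "S = (\<Sum>i=1..M. \<beta> i n \<omega> * (norm (p i n \<omega> - x n \<omega>))\<^sup>2)"
        have \<beta>0: "0 \<le> \<beta> i n \<omega>" if "i \<in> {1..M}" for i
          using assms(19)[OF that \<omega>, of n] by simp
        have z: "(norm (p i n \<omega> - x n \<omega>))\<^sup>2 \<le> inner (z - x n \<omega>) (p i n \<omega> - x n \<omega>)"
          if "z \<in> Z" "i \<in> {1..M}" for z i
          unfolding assms(17)[OF that(2) \<omega>]
        proof (rule firmly_quasinonexpansive_inner)
          show "firmly_quasinonexpansive (T (kk i n \<omega>))"
            using assms(3) measurable_space[OF kk(1)[OF that(2)] \<omega>] by blast
          show "z \<in> Fix (T (kk i n \<omega>))" using elim(5) that by blast
        qed
        have lam: "\<epsilon> \<le> lam n \<omega>" "lam n \<omega> \<le> 1" using elim(2) by auto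
        have sum1: "(\<Sum>i=1..M. \<beta> i n \<omega>) = 1" using elim(1) by blast
        note step' = relaxed_extrapolation[where p="\<lambda>i. p i n \<omega>" and c="\<lambda>i. \<beta> i n \<omega>",
            OF finite_atLeastAtMost \<beta>0 sum1 z assms(22)[OF \<omega>, of n] S_def
              assms(23)[OF \<omega>, of n, folded S_def] assms(24)[OF \<omega>, of n] assms(13) lam
              assms(27)[OF \<omega>, of n]]
        show "Z \<subseteq> half (x n \<omega>) (r n \<omega>)" using step'(1) by blast
        have "\<delta> * (norm (p 1 n \<omega> - x n \<omega>))\<^sup>2 \<le> S"
          unfolding S_def using elim(4) \<beta>0 one assms(11)
          by (intro weighted_sum_square_ge) auto
        then have "\<epsilon>\<^sup>2 * (\<delta> * (norm (p 1 n \<omega> - x n \<omega>))\<^sup>2) \<le> \<epsilon>\<^sup>2 * S"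
          by (intro mult_left_mono) auto
        \<comment> \<open>The estimate \<open>step'(2)\<close> is still conditional on a point of
          \<open>Z\<close>, which nonemptiness supplies.\<close>
        also have "\<dots> \<le> (norm (r n \<omega> - x n \<omega>))\<^sup>2" using assms(8) step'(2) by blast
        finally show "\<epsilon>\<^sup>2 * \<delta> * (norm (p 1 n \<omega> - x n \<omega>))\<^sup>2 \<le> (norm (r n \<omega> - x n \<omega>))\<^sup>2"
          by (simp add: mult.assoc)
      qed
      have "haugazeau (\<lambda>n. x n \<omega>) (\<lambda>n. r n \<omega>) Z"
        using Z assms(8) step(1) elim(3) by unfold_locales auto
      then show ?case using step(2) by blast
    qed
  qed

  \<comment> \<open>Summability of the expected displacements\<close>
  obtain z where z: "z \<in> Z" using assms(8) by blast
  define C where "C = 1 / (\<epsilon>\<^sup>2 * \<delta>)"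
  have z_L2: "in_L2 P (\<lambda>\<omega>. x 0 \<omega> - z)"
    using in_L2_add[OF assms(9), of "\<lambda>_. - z"] by (simp add: in_L2_def)
  have sum_le: "AE \<omega> in P. \<forall>N. (\<Sum>n<N. (norm (p 1 n \<omega> - x n \<omega>))\<^sup>2) \<le> C * (norm (x 0 \<omega> - z))\<^sup>2"
    using AE_step
  proof eventually_elim
    case (elim \<omega>)
    then interpret haugazeau "\<lambda>n. x n \<omega>" "\<lambda>n. r n \<omega>" Z by blast
    show ?case
    proof
      fix N
      have "\<epsilon>\<^sup>2 * \<delta> * (\<Sum>n<N. (norm (p 1 n \<omega> - x n \<omega>))\<^sup>2) \<le> (\<Sum>n<N. (norm (r n \<omega> - x n \<omega>))\<^sup>2)"
        unfolding sum_distrib_left using elim by (intro sum_mono) blast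
      also have "\<dots> \<le> (norm (x 0 \<omega> - z))\<^sup>2"
        using sum_r_le[OF z] by (simp add: norm_minus_commute)
      finally show "(\<Sum>n<N. (norm (p 1 n \<omega> - x n \<omega>))\<^sup>2) \<le> C * (norm (x 0 \<omega> - z))\<^sup>2"
        using \<delta>\<epsilon> unfolding C_def by (simp add: field_simps)
    qed
  qed

  \<comment> \<open>Values in \<open>ennreal\<close> let sums and integrals be exchanged before
    finiteness is known.\<close>
  define f where "f q = ennreal ((norm (T (fst q) (snd q) - snd q))\<^sup>2)" for q
  have f_meas [measurable]: "f \<in> borel_measurable (K \<Otimes>\<^sub>M borel)"
  proof -
    have [measurable]: "(\<lambda>q. T (fst q) (snd q)) \<in> borel_measurable (K \<Otimes>\<^sub>M borel)"
      using assms(4) by (simp add: case_prod_beta')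
    show ?thesis unfolding f_def by measurable
  qed
  note kk1 [measurable] = kk(1)[OF one]
  have f_kk: "f (kk 1 n \<omega>, x n \<omega>) = ennreal ((norm (p 1 n \<omega> - x n \<omega>))\<^sup>2)" if "\<omega> \<in> space P" for n \<omega>
    using assms(17)[OF one that, of n] by (simp add: f_def)
  have "(\<Sum>n. \<integral>\<^sup>+\<omega>. f (kk 1 n \<omega>, x n \<omega>) \<partial>P) = (\<integral>\<^sup>+\<omega>. (\<Sum>n. f (kk 1 n \<omega>, x n \<omega>)) \<partial>P)"
    by (rule nn_integral_suminf[symmetric]) measurable
  also have "\<dots> \<le> (\<integral>\<^sup>+\<omega>. ennreal (C * (norm (x 0 \<omega> - z))\<^sup>2) \<partial>P)"
  proof (rule nn_integral_mono_AE)
    show "AE \<omega> in P. (\<Sum>n. f (kk 1 n \<omega>, x n \<omega>)) \<le> ennreal (C * (norm (x 0 \<omega> - z))\<^sup>2)"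
      using sum_le AE_space
    proof eventually_elim
      case (elim \<omega>)
      then show ?case
        by (intro suminf_le_const summableI) (simp add: f_kk ennreal_leI del: One_nat_def)
    qed
  qed
  also have "\<dots> = ennreal (\<integral>\<omega>. C * (norm (x 0 \<omega> - z))\<^sup>2 \<partial>P)"
    using z_L2 \<delta>\<epsilon> unfolding in_L2_def
    by (intro nn_integral_eq_integral integrable_mult_right) (auto simp: C_def)
  finally have fin: "(\<Sum>n. \<integral>\<^sup>+\<omega>. f (kk 1 n \<omega>, x n \<omega>) \<partial>P) \<noteq> \<infinity>"
    by (metis ennreal_less_top infinity_ennreal_def not_less)
  have joint: "distr P (K \<Otimes>\<^sub>M borel) (\<lambda>\<omega>. (kk 1 n \<omega>, x n \<omega>)) = \<mu> \<Otimes>\<^sub>M distr P borel (x n)" for n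
    using distr_pair_indep[OF assms(16)[OF one] kk1] kk(2)[OF one] by simp
  \<comment> \<open>The random index is now replaced by a fixed \<open>\<kappa>\<close> common to
    all \<open>n\<close>; the exceptional \<open>\<mu>\<close>-null set may depend on
    \<open>\<omega>\<close>.\<close>
  have AE_sum: "AE \<omega> in P. AE \<kappa> in \<mu>. (\<Sum>n. f (\<kappa>, x n \<omega>)) \<noteq> \<infinity>"
    by (rule AE_independent_sampling[OF \<mu>(1,2) kk1 x_meas f_meas joint fin])

  \<comment> \<open>Almost sure convergence\<close>
  have conv: "AE \<omega> in P. (\<lambda>n. x n \<omega>) \<longlonglongrightarrow> proj Z (x 0 \<omega>)"
    using AE_step AE_sum
  proof eventually_elim
    case (elim \<omega>)
    then interpret haugazeau "\<lambda>n. x n \<omega>" "\<lambda>n. r n \<omega>" Z by blast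
    show ?case
    proof (rule strong_convergence)
      fix s :: "nat \<Rightarrow> nat" and w
      assume s: "strict_mono s" and w: "weakly_converges ((\<lambda>n. x n \<omega>) \<circ> s) w"
      \<comment> \<open>For almost every \<open>\<kappa>\<close> the displacements along the path
        are square summable, hence tend to zero, and demiclosedness applies to the weakly convergent
        subsequence.\<close>
      have "AE \<kappa> in \<mu>. w \<in> Fix (T \<kappa>)"
        using elim(2) AE_space
      proof eventually_elim
        case (elim \<kappa>)
        have "summable (\<lambda>n. (norm (T \<kappa> (x n \<omega>) - x n \<omega>))\<^sup>2)"
          using elim(1) by (intro summable_suminf_not_top) (auto simp: f_def)
        then have "(\<lambda>n. (norm (T \<kappa> (x n \<omega>) - x n \<omega>))\<^sup>2) \<longlonglongrightarrow> 0"
          by (rule summable_LIMSEQ_zero)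
        then have "(\<lambda>n. sqrt ((norm (T \<kappa> (x n \<omega>) - x n \<omega>))\<^sup>2)) \<longlonglongrightarrow> sqrt 0"
          by (rule tendsto_real_sqrt)
        then have "(\<lambda>n. norm (x n \<omega> - T \<kappa> (x n \<omega>))) \<longlonglongrightarrow> 0"
          by (subst norm_minus_commute) simp
        then have "(\<lambda>n. x n \<omega> - T \<kappa> (x n \<omega>)) \<longlonglongrightarrow> 0"
          by (rule tendsto_norm_zero_cancel)
        from LIMSEQ_subseq_LIMSEQ[OF this s]
        have "(\<lambda>n. ((\<lambda>n. x n \<omega>) \<circ> s) n - T \<kappa> (((\<lambda>n. x n \<omega>) \<circ> s) n)) \<longlonglongrightarrow> 0"
          by (simp add: o_def)
        then have "w - T \<kappa> w = 0"
          using assms(5)[of \<kappa>] elim(2) w unfolding demiclosed_at_def \<mu>(3) by blast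
        then show ?case by (simp add: Fix_def)
      qed
      then show "w \<in> Z" by (simp add: Z_iff)
    qed
  qed

  \<comment> \<open>Convergence in mean square\<close>
  have dist0: "AE \<omega> in P. \<forall>n. norm (x n \<omega> - x 0 \<omega>) \<le> norm (x 0 \<omega> - z)"
    using AE_step
  proof eventually_elim
    case (elim \<omega>)
    then interpret haugazeau "\<lambda>n. x n \<omega>" "\<lambda>n. r n \<omega>" Z by blast
    show ?case using dist_le[OF z] by (simp add: norm_minus_commute)
  qed
  have proj0: "norm (proj Z (x 0 \<omega>) - x 0 \<omega>) \<le> norm (x 0 \<omega> - z)" for \<omega>
    using proj_le[OF Z assms(8) z, of "x 0 \<omega>"] by (simp add: dist_norm norm_minus_commute)
  have proj_meas [measurable]: "(\<lambda>\<omega>. proj Z (x 0 \<omega>)) \<in> borel_measurable P"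
    by (intro borel_measurable_continuous_on[OF continuous_on_proj] Z assms(8) x_meas)
  \<comment> \<open>Only the difference from \<open>x 0\<close> is dominated, so \<open>x 0\<close>
    is added back inside the space.\<close>
  have L2_near: "in_L2 P g" if [measurable]: "g \<in> borel_measurable P"
    and "AE \<omega> in P. norm (g \<omega> - x 0 \<omega>) \<le> norm (x 0 \<omega> - z)" for g
  proof -
    have "in_L2 P (\<lambda>\<omega>. g \<omega> - x 0 \<omega>)"
      by (rule in_L2_dominated[OF z_L2]) (use that in auto)
    from in_L2_add[OF this assms(9)] show ?thesis by simp
  qed
  have "(\<lambda>n. LINT \<omega>|P. (norm (x n \<omega> - proj Z (x 0 \<omega>)))\<^sup>2) \<longlonglongrightarrow> (LINT \<omega>|P. 0)"
  \<comment> \<open>Both \<open>x n\<close> and the limit lie within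
    \<open>norm (x 0 \<omega> - z)\<close> of \<open>x 0\<close>; the triangle inequality doubles
    this, and squaring gives the factor 4.\<close>
  proof (rule integral_dominated_convergence[where w="\<lambda>\<omega>. 4 * (norm (x 0 \<omega> - z))\<^sup>2"])
    show "integrable P (\<lambda>\<omega>. 4 * (norm (x 0 \<omega> - z))\<^sup>2)"
      using z_L2 unfolding in_L2_def by (intro integrable_mult_right) auto
    show "AE \<omega> in P. (\<lambda>n. (norm (x n \<omega> - proj Z (x 0 \<omega>)))\<^sup>2) \<longlonglongrightarrow> 0"
      using conv
    proof eventually_elim
      case (elim \<omega>)
      have "(\<lambda>n. (norm (x n \<omega> - proj Z (x 0 \<omega>)))\<^sup>2) \<longlonglongrightarrow> (norm (proj Z (x 0 \<omega>) - proj Z (x 0 \<omega>)))\<^sup>2"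
        by (intro tendsto_intros elim)
      then show ?case by simp
    qed
    show "AE \<omega> in P. norm ((norm (x n \<omega> - proj Z (x 0 \<omega>)))\<^sup>2) \<le> 4 * (norm (x 0 \<omega> - z))\<^sup>2" for n
      using dist0
    proof eventually_elim
      case (elim \<omega>)
      have "norm (x n \<omega> - proj Z (x 0 \<omega>)) \<le> norm (x n \<omega> - x 0 \<omega>) + norm (proj Z (x 0 \<omega>) - x 0 \<omega>)"
        using norm_triangle_ineq4[of "x n \<omega> - x 0 \<omega>" "proj Z (x 0 \<omega>) - x 0 \<omega>"] by simp
      also have "\<dots> \<le> norm (x 0 \<omega> - z) + norm (x 0 \<omega> - z)"
        using elim proj0 by (intro add_mono) auto
      finally have "norm (x n \<omega> - proj Z (x 0 \<omega>)) \<le> 2 * norm (x 0 \<omega> - z)" by simp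
      then have "(norm (x n \<omega> - proj Z (x 0 \<omega>)))\<^sup>2 \<le> (2 * norm (x 0 \<omega> - z))\<^sup>2"
        by (intro power_mono) auto
      then show ?case by (simp add: power_mult_distrib)
    qed
  qed measurable
  from tendsto_real_sqrt[OF this]
  have "(\<lambda>n. sqrt (LINT \<omega>|P. (norm (x n \<omega> - proj Z (x 0 \<omega>)))\<^sup>2)) \<longlonglongrightarrow> 0" by simp
  moreover have "in_L2 P (x n)" for n using dist0 by (intro L2_near) auto
  moreover have "in_L2 P (\<lambda>\<omega>. proj Z (x 0 \<omega>))" using proj0 by (intro L2_near) auto
  ultimately show ?thesis using conv by (simp add: converges_in_L2_def)
qed

end
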